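(* Fix an integer $n\ge2$. Then, for every $q\in(1,\infty)$, there exists a constant $\mathcal{N}=\mathcal{N}(n,q)$ such that, for every bounded domain $V\subset\mathbb{R}^n$, $$[\phi]_{\mathrm{BMO}(V)}\le\sup_{Q\subset\subset V}\bigg(\frac1{|Q|}\int_Q|\phi(\mathbf{x})-\langle\phi\rangle_Q|^q\,d\mathbf{x}\bigg)^{1/q}\le\mathcal{N}(n,q)\,[\phi]_{\mathrm{BMO}(V)}$$ for all $\phi\in\mathrm{BMO}(V)$, where the supremum is over all nonempty, bounded, open cubes $Q\subset\subset V$ with faces parallel to the coordinate hyperplanes.
   Context: A domain is a nonempty, connected, open set. $Q\subset\subset V$ means that $Q$ is contained in some compact subset of $V$. $\langle\phi\rangle_Q:=\frac1{|Q|}\int_Q\phi\,d\mathbf{x}$. For $\phi\in L^1_{\mathrm{loc}}(V)$ (real-valued), $[\phi]_{\mathrm{BMO}(V)}:=\sup_{Q\subset\subset V}\frac1{|Q|}\int_Q|\phi(\mathbf{x})-\langle\phi\rangle_Q|\,d\mathbf{x}$, with the supremum over the same class of cubes, and $\mathrm{BMO}(V):=\{\phi\in L^1_{\mathrm{loc}}(V):[\phi]_{\mathrm{BMO}(V)}<\infty\}$. *)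

theory Defs
  imports "HOL-Analysis.Analysis"
begin

definition domain :: "(real^'n) set \<Rightarrow> bool" where
  "domain V \<longleftrightarrow> V \<noteq> {} \<and> connected V \<and> open V"

definition compactly_inside :: "(real^'n) set \<Rightarrow> (real^'n) set \<Rightarrow> bool"
    (infix "\<subset>\<subset>" 50) where
  "Q \<subset>\<subset> V \<longleftrightarrow> (\<exists>K. compact K \<and> K \<subseteq> V \<and> Q \<subseteq> K)"

text \<open>The nonempty bounded open cube with sides parallel to the axes is determined by its
  lower corner \<open>a\<close> and its side length \<open>l > 0\<close>.\<close>

definition open_cube :: "(real^'n) set \<Rightarrow> bool" where
  "open_cube Q \<longleftrightarrow> (\<exists>a l. 0 < l \<and> Q = box a (\<chi> i. a $ i + l))"

definition cubes_in :: "(real^'n) set \<Rightarrow> (real^'n) set set" where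
  "cubes_in V = {Q. open_cube Q \<and> Q \<subset>\<subset> V}"

text \<open>Functions on \<open>V\<close> are total functions whose values outside \<open>V\<close> are never used.\<close>

definition L1_loc :: "(real^'n) set \<Rightarrow> (real^'n \<Rightarrow> real) set" where
  "L1_loc V = {\<phi>. \<forall>K. compact K \<and> K \<subseteq> V \<longrightarrow> set_integrable lebesgue K \<phi>}"

definition cube_mean :: "(real^'n) set \<Rightarrow> (real^'n \<Rightarrow> real) \<Rightarrow> real" where
  "cube_mean Q \<phi> = (1 / measure lebesgue Q) * (LINT x:Q|lebesgue. \<phi> x)"

text \<open>The oscillations are Lebesgue integrals of nonnegative functions with values in
  \<open>[0, \<infinity>]\<close>, so that no finiteness of the \<open>q\<close>-th powers or of the suprema is presupposed.\<close>

definition mean_osc :: "(real^'n) set \<Rightarrow> (real^'n \<Rightarrow> real) \<Rightarrow> ennreal" where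
  "mean_osc Q \<phi> =
     (\<integral>\<^sup>+x\<in>Q. ennreal \<bar>\<phi> x - cube_mean Q \<phi>\<bar> \<partial>lebesgue) / emeasure lebesgue Q"

definition bmo_seminorm :: "(real^'n) set \<Rightarrow> (real^'n \<Rightarrow> real) \<Rightarrow> ennreal" where
  "bmo_seminorm V \<phi> = (SUP Q\<in>cubes_in V. mean_osc Q \<phi>)"

definition BMO :: "(real^'n) set \<Rightarrow> (real^'n \<Rightarrow> real) set" where
  "BMO V = {\<phi> \<in> L1_loc V. bmo_seminorm V \<phi> < \<infinity>}"

text \<open>The power of an element of \<open>[0, \<infinity>]\<close>, meant for exponents \<open>p > 0\<close>.\<close>

definition ennreal_power :: "ennreal \<Rightarrow> real \<Rightarrow> ennreal" where
  "ennreal_power x p = (if x = \<infinity> then \<infinity> else ennreal (enn2real x powr p))"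

definition mean_osc_power :: "real \<Rightarrow> (real^'n) set \<Rightarrow> (real^'n \<Rightarrow> real) \<Rightarrow> ennreal" where
  "mean_osc_power q Q \<phi> =
     (\<integral>\<^sup>+x\<in>Q. ennreal (\<bar>\<phi> x - cube_mean Q \<phi>\<bar> powr q) \<partial>lebesgue) / emeasure lebesgue Q"

end

theory Submission
  imports Defs
begin

text \<open>
  John--Nirenberg by a finite dyadic martingale. For a cube of side \<open>l\<close>, let \<open>f\<^sub>k\<close> be the conditional
  expectation of \<open>f\<close> on the dyadic subcubes of generation \<open>k\<close>. An oscillation bound \<open>B\<close> on all subcubes
  forces the averages of a cube and of a dyadic child to differ by at most \<open>2\<^sup>n B\<close>. Stopping at the first
  subcubes on which the average leaves the window of radius \<open>2 B\<close> around the initial average \<open>c\<close> costs a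
  factor \<open>exp (r (2 + 2\<^sup>n) B) = 3 / 2\<close>, while by Chebyshev the stopped cubes fill at most half of the
  cube. This closes an induction on \<open>k\<close> giving a mean of \<open>exp (r \<bar>f\<^sub>k - c\<bar>)\<close> of at most 6, and
  \<open>f\<^sub>k \<rightarrow> f\<close> in \<open>L\<^sup>1\<close> together with Fatou's lemma transfers it to \<open>f\<close>. The lower bound is Jensen's inequality.
\<close>

section \<open>Half-open dyadic cubes: partition, measurability, volume\<close>

text \<open>Half-open cubes, so that the dyadic children partition their parent exactly.\<close>

definition hcube :: "real^'n \<Rightarrow> real \<Rightarrow> (real^'n) set" where
  "hcube a l = {x. \<forall>i. a $ i \<le> x $ i \<and> x $ i < a $ i + l}"

text \<open>The 2^n children are indexed by the set \<open>s\<close> of coordinates in which the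
  upper half is taken. \<open>half\<close> recovers this index from a point, so the child containing
  \<open>x\<close> is named without any choice.\<close>

definition corner :: "real^'n \<Rightarrow> real \<Rightarrow> 'n set \<Rightarrow> real^'n" where
  "corner a l s = (\<chi> i. a $ i + (if i \<in> s then l / 2 else 0))"

definition half :: "real^'n \<Rightarrow> real \<Rightarrow> real^'n \<Rightarrow> 'n set" where
  "half a l x = {i. a $ i + l / 2 \<le> x $ i}"

lemma mem_hcube_corner:
  assumes "0 < l"
  shows "x \<in> hcube (corner a l s) (l / 2) \<longleftrightarrow> x \<in> hcube a l \<and> half a l x = s"
proof -
  have "(a $ i + (if i \<in> s then l/2 else 0) \<le> x $ i \<and> x $ i < a $ i + (if i \<in> s then l/2 else 0) + l/2)
    \<longleftrightarrow> (a $ i \<le> x $ i \<and> x $ i < a $ i + l) \<and> (a $ i + l / 2 \<le> x $ i \<longleftrightarrow> i \<in> s)" for i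
    using assms by (auto simp: field_simps)
  then show ?thesis
    unfolding hcube_def corner_def half_def by auto
qed

lemma hcube_corner_subset: "0 < l \<Longrightarrow> hcube (corner a l s) (l / 2) \<subseteq> hcube a l"
  using mem_hcube_corner by blast

lemma sets_hcube [measurable]: "hcube a l \<in> sets borel"
proof -
  have "hcube a l = {x\<in>space borel. \<forall>i\<in>UNIV. a $ i \<le> x $ i \<and> x $ i < a $ i + l}"
    by (auto simp: hcube_def)
  also have "\<dots> \<in> sets borel"
    by measurable
  finally show ?thesis .
qed

lemma sets_half [measurable]: "{x. half a l x = s} \<in> sets borel"
proof -
  have "{x. half a l x = s} = {x\<in>space borel. \<forall>i\<in>UNIV. (a $ i + l / 2 \<le> x $ i) = (i \<in> s)}"
    by (auto simp: half_def)
  also have "\<dots> \<in> sets borel"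
    by measurable
  finally show ?thesis .
qed

lemma sets_hcube_lebesgue [measurable]: "hcube a l \<in> sets lebesgue"
  by (simp add: sets_hcube)

text \<open>Both cubes lie between the open and the closed box, which differ only by the faces, a
  null set. Integrals over the open cubes of the theorem thus become integrals over half-open
  ones.\<close>

lemma AE_box_hcube:
  "AE x in lebesgue. x \<in> box a (\<chi> i. a $ i + l) \<longleftrightarrow> x \<in> hcube a l"
proof -
  let ?b = "\<chi> i. a $ i + l"
  have "cbox a ?b - box a ?b \<in> null_sets lebesgue"
    using negligible_frontier_interval by (simp add: negligible_iff_null_sets)
  then have "AE x in lebesgue. x \<notin> cbox a ?b - box a ?b"
    by (rule AE_not_in)
  then show ?thesis
  proof eventually_elim
    case (elim x)
    then show ?case
      by (auto simp: hcube_def mem_box_cart) (meson less_imp_le)+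
  qed
qed

lemma set_nn_integral_box_hcube:
  "(\<integral>\<^sup>+x\<in>box a (\<chi> i. a $ i + l). g x \<partial>lebesgue) = (\<integral>\<^sup>+x\<in>hcube a l. g x \<partial>lebesgue)"
  by (rule nn_integral_cong_AE, rule AE_mp[OF AE_box_hcube[of a l]]) (auto simp: indicator_def)

lemma emeasure_box_cube:
  fixes a :: "real^'n"
  assumes "0 \<le> l"
  shows "emeasure lebesgue (box a (\<chi> i. a $ i + l)) = ennreal (l ^ CARD('n))"
proof -
  have "emeasure lebesgue (box a (\<chi> i. a $ i + l)) = emeasure lborel (box a (\<chi> i. a $ i + l))"
    by simp
  also have "\<dots> = (\<Prod>b\<in>Basis. ((\<chi> i. a $ i + l) - a) \<bullet> b)"
    using assms by (intro emeasure_lborel_box) (auto simp: Basis_vec_def inner_axis)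
  also have "(\<Prod>b\<in>Basis. ((\<chi> i. a $ i + l) - a) \<bullet> b) = (\<Prod>b\<in>(Basis::(real^'n) set). l)"
    by (rule prod.cong) (auto simp: Basis_vec_def inner_axis)
  finally show ?thesis by simp
qed

lemma emeasure_hcube:
  fixes a :: "real^'n"
  assumes "0 \<le> l"
  shows "emeasure lborel (hcube a l) = ennreal (l ^ CARD('n))"
  using set_nn_integral_box_hcube[where g = "\<lambda>_. 1", of a l] emeasure_box_cube[OF assms, of a]
  by (simp add: sets_hcube)

lemma set_nn_integral_const_hcube:
  fixes a :: "real^'n"
  assumes "0 \<le> l" "0 \<le> c"
  shows "(\<integral>\<^sup>+x\<in>hcube a l. ennreal c \<partial>lebesgue) = ennreal (c * l ^ CARD('n))"
  using assms by (simp add: nn_integral_cmult_indicator emeasure_hcube ennreal_mult sets_hcube)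

text \<open>Each point of the cube lies in exactly one child, so the indicators of the children sum
  to that of the cube. Measurability is asked only after cutting \<open>g\<close> off to the cube,
  since nothing is known about a locally integrable function outside \<open>V\<close>.\<close>

lemma set_nn_integral_hcube_corner:
  fixes g :: "real^'n \<Rightarrow> ennreal"
  assumes "0 < l" and g: "(\<lambda>x. g x * indicator (hcube a l) x) \<in> borel_measurable lebesgue"
  shows "(\<integral>\<^sup>+x\<in>hcube a l. g x \<partial>lebesgue)
    = (\<Sum>s\<in>UNIV. \<integral>\<^sup>+x\<in>hcube (corner a l s) (l / 2). g x \<partial>lebesgue)"
proof -
  have eq: "g x * indicator (hcube (corner a l s) (l / 2)) x
      = g x * indicator (hcube a l) x * indicator (hcube (corner a l s) (l / 2)) x" for x s
    using mem_hcube_corner[OF assms(1)] by (auto simp: indicator_def)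
  have "(\<Sum>s\<in>UNIV. g x * indicator (hcube (corner a l s) (l / 2)) x) = g x * indicator (hcube a l) x" for x
  proof -
    have "(\<Sum>s\<in>UNIV. g x * indicator (hcube (corner a l s) (l / 2)) x)
        = (\<Sum>s\<in>UNIV. if s = half a l x then g x * indicator (hcube a l) x else 0)"
      by (rule sum.cong) (auto simp: indicator_def mem_hcube_corner[OF assms(1)])
    then show ?thesis by simp
  qed
  then have "(\<integral>\<^sup>+x\<in>hcube a l. g x \<partial>lebesgue)
      = (\<integral>\<^sup>+x. (\<Sum>s\<in>UNIV. g x * indicator (hcube (corner a l s) (l / 2)) x) \<partial>lebesgue)"
    by simp
  also have "\<dots> = (\<Sum>s\<in>UNIV. \<integral>\<^sup>+x\<in>hcube (corner a l s) (l / 2). g x \<partial>lebesgue)"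
  proof (rule nn_integral_sum)
    fix s show "(\<lambda>x. g x * indicator (hcube (corner a l s) (l / 2)) x) \<in> borel_measurable lebesgue"
      unfolding eq[abs_def] by (rule borel_measurable_times_ennreal[OF g borel_measurable_indicator]) (simp add: sets_hcube)
  qed
  finally show ?thesis .
qed

section \<open>Averages and dyadic conditional expectations\<close>

definition avg :: "(real^'n \<Rightarrow> real) \<Rightarrow> real^'n \<Rightarrow> real \<Rightarrow> real" where
  "avg f a l = (LINT x:hcube a l|lebesgue. f x) / l ^ CARD('n)"

lemma measurable_set_abs_diff:
  assumes "set_integrable lebesgue H f" "set_integrable lebesgue H g"
  shows "(\<lambda>x. ennreal \<bar>f x - g x\<bar> * indicator H x) \<in> borel_measurable lebesgue"
proof -
  have "set_integrable lebesgue H (\<lambda>x. f x - g x)"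
    using assms by (rule set_integral_diff(1))
  then have "(\<lambda>x. ennreal \<bar>indicator H x *\<^sub>R (f x - g x)\<bar>) \<in> borel_measurable lebesgue"
    unfolding set_integrable_def by (intro measurable_compose[OF _ measurable_ennreal] borel_measurable_abs) auto
  also have "(\<lambda>x. ennreal \<bar>indicator H x *\<^sub>R (f x - g x)\<bar>) = (\<lambda>x. ennreal \<bar>f x - g x\<bar> * indicator H x)"
    by (auto simp: indicator_def)
  finally show ?thesis .
qed

text \<open>Averaging is an L^1 contraction. The volume is multiplied out to keep division in
  \<open>ennreal\<close> away.\<close>

lemma avg_diff_le:
  fixes a :: "real^'n"
  assumes "0 < l" "set_integrable lebesgue (hcube a l) f" "set_integrable lebesgue (hcube a l) g"
  shows "ennreal (\<bar>avg f a l - avg g a l\<bar> * l ^ CARD('n)) \<le> (\<integral>\<^sup>+x\<in>hcube a l. ennreal \<bar>f x - g x\<bar> \<partial>lebesgue)"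
proof -
  have int: "set_integrable lebesgue (hcube a l) (\<lambda>x. f x - g x)"
    using assms by (intro set_integral_diff(1))
  have "\<bar>avg f a l - avg g a l\<bar> * l ^ CARD('n) = norm (LINT x:hcube a l|lebesgue. f x - g x)"
    using assms by (simp add: avg_def set_integral_diff(2) flip: diff_divide_distrib)
  also have "ennreal \<dots> \<le> (\<integral>\<^sup>+x. norm (indicator (hcube a l) x *\<^sub>R (f x - g x)) \<partial>lebesgue)"
    using int unfolding set_lebesgue_integral_def set_integrable_def by (rule integral_norm_bound_ennreal)
  also have "\<dots> = (\<integral>\<^sup>+x\<in>hcube a l. ennreal \<bar>f x - g x\<bar> \<partial>lebesgue)"
    by (intro nn_integral_cong) (auto simp: indicator_def)
  finally show ?thesis .
qed

lemma set_integrable_const_hcube: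
  assumes "0 \<le> l" shows "set_integrable lebesgue (hcube a l) (\<lambda>_. c::real)"
  using emeasure_hcube[OF assms, of a] unfolding set_integrable_def
  by (intro integrable_scaleR_left integrable_real_indicator) (auto simp: sets_hcube)

lemma avg_const:
  assumes "0 < l" shows "avg (\<lambda>_. c) a l = c"
  using assms by (simp add: avg_def set_lebesgue_integral_def emeasure_hcube measure_def sets_hcube)

lemma avg_diff_const_le:
  fixes a :: "real^'n"
  assumes "0 < l" "set_integrable lebesgue (hcube a l) f"
  shows "ennreal (\<bar>avg f a l - c\<bar> * l ^ CARD('n)) \<le> (\<integral>\<^sup>+x\<in>hcube a l. ennreal \<bar>f x - c\<bar> \<partial>lebesgue)"
  using avg_diff_le[OF assms set_integrable_const_hcube, of c] assms(1) by (simp add: avg_const)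

text \<open>\<open>dexp f k a l\<close> is the function \<open>f\<^sub>k\<close> above for the cube \<open>hcube a l\<close>; only its values there matter.\<close>

primrec dexp :: "(real^'n \<Rightarrow> real) \<Rightarrow> nat \<Rightarrow> real^'n \<Rightarrow> real \<Rightarrow> real^'n \<Rightarrow> real" where
  "dexp f 0 a l x = avg f a l"
| "dexp f (Suc k) a l x = dexp f k (corner a l (half a l x)) (l / 2) x"

text \<open>For every \<open>f\<close> this is a step function with constant values on finitely many
  Borel pieces. Since the recursion picks the child by way of \<open>x\<close>, it is first
  rewritten as a finite sum over all children.\<close>

lemma borel_measurable_dexp [measurable]: "dexp f k a l \<in> borel_measurable borel"
proof (induction k arbitrary: a l)
  case (Suc k)
  have "dexp f (Suc k) a l x = (\<Sum>s\<in>UNIV. indicator {x. half a l x = s} x * dexp f k (corner a l s) (l / 2) x)" for x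
  proof -
    have "(\<Sum>s\<in>UNIV. indicator {x. half a l x = s} x * dexp f k (corner a l s) (l / 2) x)
       = (\<Sum>s\<in>UNIV. if s = half a l x then dexp f k (corner a l s) (l / 2) x else 0)"
      by (rule sum.cong) (auto simp: indicator_def)
    then show ?thesis by simp
  qed
  moreover have "(\<lambda>x. \<Sum>s\<in>UNIV. indicator {x. half a l x = s} x * dexp f k (corner a l s) (l / 2) x) \<in> borel_measurable borel"
    using Suc by measurable
  ultimately show ?case by presburger
next
  case 0
  have "dexp f 0 a l = (\<lambda>_. avg f a l)" by auto
  then show ?case by simp
qed

lemma borel_measurable_dexp_lebesgue [measurable]: "dexp f k a l \<in> borel_measurable lebesgue"
  using borel_measurable_dexp by (intro measurable_completion) simp

lemma set_integrable_corner:
  fixes f :: "real^'n \<Rightarrow> real"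
  assumes "0 < l" "set_integrable lebesgue (hcube a l) f"
  shows "set_integrable lebesgue (hcube (corner a l s) (l / 2)) f"
  using assms(2) by (rule set_integrable_subset) (use assms hcube_corner_subset in \<open>auto simp: sets_hcube\<close>)

lemma dexp_Suc_corner:
  assumes "0 < l" "x \<in> hcube (corner a l s) (l / 2)"
  shows "dexp f (Suc k) a l x = dexp f k (corner a l s) (l / 2) x"
  using assms by (simp add: mem_hcube_corner)

text \<open>Averaging contracts L^1 on each cube of generation \<open>k\<close>, and both sides add
  up over the children. This controls the error when \<open>f\<close> is replaced by a continuous
  function.\<close>

lemma dexp_contraction:
  fixes a :: "real^'n"
  assumes "0 < l" "set_integrable lebesgue (hcube a l) f" "set_integrable lebesgue (hcube a l) g"
  shows "(\<integral>\<^sup>+x\<in>hcube a l. ennreal \<bar>dexp f k a l x - dexp g k a l x\<bar> \<partial>lebesgue)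
    \<le> (\<integral>\<^sup>+x\<in>hcube a l. ennreal \<bar>f x - g x\<bar> \<partial>lebesgue)"
  using assms
proof (induction k arbitrary: a l)
  case 0
  then show ?case
    using avg_diff_le[OF 0] by (simp add: set_nn_integral_const_hcube del: nn_integral_indicator)
next
  case (Suc k)
  have "(\<integral>\<^sup>+x\<in>hcube a l. ennreal \<bar>dexp f (Suc k) a l x - dexp g (Suc k) a l x\<bar> \<partial>lebesgue)
     = (\<Sum>s\<in>UNIV. \<integral>\<^sup>+x\<in>hcube (corner a l s) (l / 2). ennreal \<bar>dexp f (Suc k) a l x - dexp g (Suc k) a l x\<bar> \<partial>lebesgue)"
    by (rule set_nn_integral_hcube_corner[OF Suc.prems(1)]) measurable
  also have "\<dots> = (\<Sum>s\<in>UNIV. \<integral>\<^sup>+x\<in>hcube (corner a l s) (l / 2).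
      ennreal \<bar>dexp f k (corner a l s) (l / 2) x - dexp g k (corner a l s) (l / 2) x\<bar> \<partial>lebesgue)"
    by (intro sum.cong nn_integral_cong) (auto simp: indicator_def dexp_Suc_corner[OF Suc.prems(1)] simp del: dexp.simps)
  also have "\<dots> \<le> (\<Sum>s\<in>UNIV. \<integral>\<^sup>+x\<in>hcube (corner a l s) (l / 2). ennreal \<bar>f x - g x\<bar> \<partial>lebesgue)"
    using Suc.prems by (intro sum_mono Suc.IH set_integrable_corner) auto
  also have "\<dots> = (\<integral>\<^sup>+x\<in>hcube a l. ennreal \<bar>f x - g x\<bar> \<partial>lebesgue)"
    using Suc.prems by (intro set_nn_integral_hcube_corner[symmetric] measurable_set_abs_diff) auto
  finally show ?case .
qed

text \<open>The value at \<open>x\<close> is the average of \<open>g\<close> over the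
  generation-\<open>k\<close> cube around \<open>x\<close>, whose side is \<open>l / 2 ^ k\<close>;
  an average of values within \<open>\<eta>\<close> of \<open>g x\<close> is within
  \<open>\<eta>\<close> of it. Passing to a child halves \<open>l\<close> and lowers
  \<open>k\<close>, which leaves \<open>l / 2 ^ k\<close> unchanged.\<close>

lemma dexp_modulus:
  fixes a :: "real^'n"
  assumes "0 < l" "set_integrable lebesgue (hcube a l) g" "x \<in> hcube a l" "0 \<le> \<eta>"
    and "\<And>x y. x \<in> hcube a l \<Longrightarrow> y \<in> hcube a l \<Longrightarrow> (\<And>i. \<bar>x $ i - y $ i\<bar> \<le> l / 2 ^ k) \<Longrightarrow> \<bar>g x - g y\<bar> \<le> \<eta>"
  shows "\<bar>dexp g k a l x - g x\<bar> \<le> \<eta>"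
  using assms
proof (induction k arbitrary: a l)
  case 0
  have "\<bar>u $ i - v $ i\<bar> \<le> l" if "u \<in> hcube a l" "v \<in> hcube a l" for u v i
    using that[unfolded hcube_def] by (auto simp: abs_le_iff dest!: spec[of _ i])
  then have "\<bar>g y - g x\<bar> \<le> \<eta>" if "y \<in> hcube a l" for y
    using 0 that by simp
  then have "(\<integral>\<^sup>+y\<in>hcube a l. ennreal \<bar>g y - g x\<bar> \<partial>lebesgue) \<le> (\<integral>\<^sup>+y\<in>hcube a l. ennreal \<eta> \<partial>lebesgue)"
    by (intro nn_integral_mono) (auto simp: indicator_def intro: ennreal_leI)
  also have "\<dots> = ennreal (\<eta> * l ^ CARD('n))"
    using 0 by (intro set_nn_integral_const_hcube) auto
  finally have "ennreal (\<bar>avg g a l - g x\<bar> * l ^ CARD('n)) \<le> ennreal (\<eta> * l ^ CARD('n))"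
    using avg_diff_const_le[OF 0(1,2), of "g x"] by (rule order_trans[rotated])
  then show ?case
    using 0 by (simp add: ennreal_le_iff)
next
  case (Suc k)
  let ?c = "corner a l (half a l x)"
  have "x \<in> hcube ?c (l / 2)"
    using Suc.prems mem_hcube_corner by blast
  then show ?case
    unfolding dexp.simps
  proof (rule Suc.IH[rotated 2])
    fix u v
    assume "u \<in> hcube ?c (l / 2)" "v \<in> hcube ?c (l / 2)" "\<And>i. \<bar>u $ i - v $ i\<bar> \<le> l / 2 / 2 ^ k"
    then show "\<bar>g u - g v\<bar> \<le> \<eta>"
      using hcube_corner_subset[OF Suc.prems(1), of a "half a l x"]
      by (intro Suc.prems(5)) (auto simp: field_simps)
  qed (use Suc.prems in \<open>auto intro: set_integrable_corner\<close>)
qed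

section \<open>Convergence of the conditional expectations to f\<close>

text \<open>A measurable function is an almost everywhere limit of continuous ones, but without a
  common bound. Truncating at height \<open>m\<close> first supplies the bound, and \<open>S\<close>
  having finite measure makes the constant \<open>2 * m\<close> an integrable majorant.\<close>

lemma L1_approx_continuous:
  fixes f :: "'a::euclidean_space \<Rightarrow> real"
  assumes f: "integrable lebesgue f" and S: "S \<in> lmeasurable" and "0 < e"
  obtains g where "continuous_on UNIV g" "(\<integral>\<^sup>+x\<in>S. ennreal \<bar>f x - g x\<bar> \<partial>lebesgue) \<le> ennreal e"
proof -
  \<comment> \<open>\<open>T m\<close> clamps to the interval from -m to m; being continuous, it
    keeps the approximants continuous.\<close>
  define T :: "real \<Rightarrow> real \<Rightarrow> real" where "T m t = max (- m) (min m t)" for m t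
  have contT: "continuous_on UNIV (T m)" for m
    unfolding T_def by (intro continuous_intros)
  have [measurable]: "T m \<in> borel_measurable borel" for m
    using contT by (rule borel_measurable_continuous_onI)
  have [measurable]: "f \<in> borel_measurable lebesgue" and [measurable]: "S \<in> sets lebesgue"
    using f S by auto
  have "(\<lambda>m. \<integral>x. \<bar>f x - T (real m) (f x)\<bar> \<partial>lebesgue) \<longlonglongrightarrow> (\<integral>x. 0 \<partial>(lebesgue :: 'a measure))"
  proof (rule integral_dominated_convergence[where w="\<lambda>x. \<bar>f x\<bar>"])
    show "AE x in lebesgue. (\<lambda>m. \<bar>f x - T (real m) (f x)\<bar>) \<longlonglongrightarrow> 0"
    proof (rule AE_I2)
      fix x
      obtain M where "\<bar>f x\<bar> \<le> real M" using real_arch_simple by blast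
      then have "\<forall>\<^sub>F m in sequentially. \<bar>f x - T (real m) (f x)\<bar> = 0"
        by (intro eventually_sequentiallyI[of M]) (auto simp: T_def)
      then show "(\<lambda>m. \<bar>f x - T (real m) (f x)\<bar>) \<longlonglongrightarrow> 0"
        by (rule tendsto_eventually)
    qed
    show "AE x in lebesgue. norm \<bar>f x - T (real m) (f x)\<bar> \<le> \<bar>f x\<bar>" for m
      by (rule AE_I2) (auto simp: T_def)
  qed (use f in auto)
  then have "\<forall>\<^sub>F m in sequentially. (\<integral>x. \<bar>f x - T (real m) (f x)\<bar> \<partial>lebesgue) < e / 2"
    using \<open>0 < e\<close> by (intro order_tendstoD(2)) auto
  then obtain m :: nat where m: "(\<integral>x. \<bar>f x - T (real m) (f x)\<bar> \<partial>lebesgue) < e / 2"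
    by (meson eventually_sequentially order_refl)
  have "f measurable_on UNIV"
    by (intro lebesgue_measurable_imp_measurable_on_real) auto
  then obtain N g where N: "negligible N" and g: "\<And>n. continuous_on UNIV (g n)"
      and lim: "\<And>x. x \<notin> N \<Longrightarrow> (\<lambda>n. g n x) \<longlonglongrightarrow> f x"
    unfolding measurable_on_def by auto
  have [measurable]: "g n \<in> borel_measurable lebesgue" for n
    using borel_measurable_continuous_onI[OF g] by (intro measurable_completion) simp
  have "AE x in lebesgue. x \<notin> N"
    using N by (intro AE_not_in) (simp add: negligible_iff_null_sets)
  have "(\<lambda>n. \<integral>x. indicator S x * \<bar>T m (f x) - T m (g n x)\<bar> \<partial>lebesgue) \<longlonglongrightarrow> (\<integral>x. 0 \<partial>(lebesgue :: 'a measure))"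
  proof (rule integral_dominated_convergence[where w="\<lambda>x. indicator S x * (2 * real m)"])
    show "AE x in lebesgue. (\<lambda>n. indicator S x * \<bar>T m (f x) - T m (g n x)\<bar>) \<longlonglongrightarrow> 0"
      using \<open>AE x in lebesgue. x \<notin> N\<close>
    proof eventually_elim
      case (elim x)
      have "(\<lambda>n. T m (g n x)) \<longlonglongrightarrow> T m (f x)"
        unfolding T_def by (intro tendsto_intros lim elim)
      then have "(\<lambda>n. \<bar>T m (f x) - T m (g n x)\<bar>) \<longlonglongrightarrow> \<bar>T m (f x) - T m (f x)\<bar>"
        by (intro tendsto_intros)
      then show ?case
        by (intro tendsto_mult_right_zero) simp
    qed
    show "AE x in lebesgue. norm (indicator S x * \<bar>T m (f x) - T m (g n x)\<bar>) \<le> indicator S x * (2 * real m)" for n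
      by (rule AE_I2) (auto simp: T_def indicator_def)
    show "integrable lebesgue (\<lambda>x. indicator S x * (2 * real m))"
      using S by (intro integrable_mult_left) (auto simp: fmeasurable_def)
  qed auto
  then have "\<forall>\<^sub>F n in sequentially. (\<integral>x. indicator S x * \<bar>T m (f x) - T m (g n x)\<bar> \<partial>lebesgue) < e / 2"
    using \<open>0 < e\<close> by (intro order_tendstoD(2)) auto
  then obtain n where n: "(\<integral>x. indicator S x * \<bar>T m (f x) - T m (g n x)\<bar> \<partial>lebesgue) < e / 2"
    by (meson eventually_sequentially order_refl)
  show ?thesis
  proof (rule that)
    show "continuous_on UNIV (\<lambda>x. T m (g n x))"
      using g[of n] unfolding T_def by (intro continuous_intros)
    have int1: "integrable lebesgue (\<lambda>x. \<bar>f x - T m (f x)\<bar>)"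
      by (rule Bochner_Integration.integrable_bound[OF f]) (auto simp: T_def)
    have int2: "integrable lebesgue (\<lambda>x. indicator S x * \<bar>T m (f x) - T m (g n x)\<bar>)"
    proof (rule Bochner_Integration.integrable_bound[of _ "\<lambda>x. indicator S x * (2 * real m)"])
      show "integrable lebesgue (\<lambda>x. indicator S x * (2 * real m))"
        using S by (intro integrable_mult_left) (auto simp: fmeasurable_def)
    qed (auto simp: T_def indicator_def)
    have "(\<integral>\<^sup>+x\<in>S. ennreal \<bar>f x - T m (g n x)\<bar> \<partial>lebesgue)
        \<le> (\<integral>\<^sup>+x. ennreal (\<bar>f x - T m (f x)\<bar> + indicator S x * \<bar>T m (f x) - T m (g n x)\<bar>) \<partial>lebesgue)"
      by (intro nn_integral_mono) (auto simp: indicator_def simp flip: ennreal_plus intro!: ennreal_leI)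
    also have "\<dots> = ennreal (\<integral>x. \<bar>f x - T m (f x)\<bar> + indicator S x * \<bar>T m (f x) - T m (g n x)\<bar> \<partial>lebesgue)"
      using int1 int2 by (intro nn_integral_eq_integral) auto
    also have "\<dots> \<le> ennreal e"
      using m n int1 int2 by (intro ennreal_leI) simp
    finally show "(\<integral>\<^sup>+x\<in>S. ennreal \<bar>f x - T m (g n x)\<bar> \<partial>lebesgue) \<le> ennreal e" .
  qed
qed

text \<open>\<open>f\<close> need not be measurable off the cube, so \<open>F\<close> is composed
  with the cut-off function instead; the outer indicator removes the spurious value
  \<open>F 0\<close> outside.\<close>

lemma measurable_set_compose:
  fixes f :: "real^'n \<Rightarrow> real" and F :: "real \<Rightarrow> ennreal"
  assumes "set_integrable lebesgue (hcube a l) f" "F \<in> borel_measurable borel"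
  shows "(\<lambda>x. F (f x) * indicator (hcube a l) x) \<in> borel_measurable lebesgue"
proof -
  have [measurable]: "(\<lambda>x. indicator (hcube a l) x *\<^sub>R f x) \<in> borel_measurable lebesgue"
    using assms(1) unfolding set_integrable_def by auto
  have [measurable]: "F \<in> borel_measurable borel" by fact
  have "(\<lambda>x. F (indicator (hcube a l) x *\<^sub>R f x) * indicator (hcube a l) x) \<in> borel_measurable lebesgue"
    by measurable
  also have "(\<lambda>x. F (indicator (hcube a l) x *\<^sub>R f x) * indicator (hcube a l) x)
      = (\<lambda>x. F (f x) * indicator (hcube a l) x)"
    by (auto simp: indicator_def)
  finally show ?thesis .
qed

text \<open>Three errors of size \<open>e / 3\<close>, for a continuous \<open>g\<close> close to
  \<open>f\<close> in L^1: from \<open>dexp f\<close> to \<open>dexp g\<close> by contraction, from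
  \<open>dexp g\<close> to \<open>g\<close> by uniform continuity on the closed cube, and from
  \<open>g\<close> to \<open>f\<close> by the choice of \<open>g\<close>.\<close>

lemma dexp_L1_limit:
  fixes a :: "real^'n"
  assumes "0 < l" and f: "set_integrable lebesgue (hcube a l) f" and "0 < e"
  shows "\<exists>K. \<forall>k\<ge>K. (\<integral>\<^sup>+x\<in>hcube a l. ennreal \<bar>dexp f k a l x - f x\<bar> \<partial>lebesgue) \<le> ennreal e"
proof -
  let ?H = "hcube a l" and ?C = "cbox a (\<chi> i. a $ i + l)"
  have HC: "?H \<subseteq> ?C"
    by (auto simp: hcube_def mem_box_cart less_imp_le)
  have H: "?H \<in> lmeasurable"
    using \<open>0 < l\<close> by (simp add: fmeasurable_def sets_hcube emeasure_hcube)
  have "integrable lebesgue (\<lambda>x. indicator ?H x *\<^sub>R f x)"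
    using f by (simp add: set_integrable_def)
  then obtain g where g: "continuous_on UNIV g"
      and "(\<integral>\<^sup>+x\<in>?H. ennreal \<bar>indicator ?H x *\<^sub>R f x - g x\<bar> \<partial>lebesgue) \<le> ennreal (e / 3)"
    using \<open>0 < e\<close> by (elim L1_approx_continuous[OF _ H, of _ "e / 3"]) auto
  moreover have "(\<integral>\<^sup>+x\<in>?H. ennreal \<bar>indicator ?H x *\<^sub>R f x - g x\<bar> \<partial>lebesgue) = (\<integral>\<^sup>+x\<in>?H. ennreal \<bar>f x - g x\<bar> \<partial>lebesgue)"
    by (intro nn_integral_cong) (auto simp: indicator_def)
  ultimately have fg: "(\<integral>\<^sup>+x\<in>?H. ennreal \<bar>f x - g x\<bar> \<partial>lebesgue) \<le> ennreal (e / 3)"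
    by simp
  have gC: "continuous_on ?C g"
    using g continuous_on_subset by blast
  have gi: "set_integrable lebesgue ?H g"
    by (rule set_integrable_subset[OF absolutely_integrable_continuous[OF gC]]) (use HC in \<open>auto simp: sets_hcube\<close>)
  \<comment> \<open>Chosen so that the constant \<open>\<eta>\<close> integrates to
    \<open>e / 3\<close> over the cube.\<close>
  define \<eta> where "\<eta> = e / 3 / l ^ CARD('n)"
  have "0 < \<eta>"
    using assms by (simp add: \<eta>_def)
  obtain \<delta> where "0 < \<delta>" and \<delta>: "\<And>x y. x \<in> ?C \<Longrightarrow> y \<in> ?C \<Longrightarrow> dist x y < \<delta> \<Longrightarrow> dist (g x) (g y) < \<eta>"
    using compact_uniformly_continuous[OF gC compact_cbox] \<open>0 < \<eta>\<close>
    unfolding uniformly_continuous_on_def by metis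
  \<comment> \<open>The factor \<open>CARD('n)\<close> pays for bounding the Euclidean distance by
    the sum of the coordinate distances.\<close>
  have "(\<lambda>k. CARD('n) * (l * (1 / 2) ^ k)) \<longlonglongrightarrow> CARD('n) * (l * 0)"
    by (intro tendsto_intros LIMSEQ_power_zero) auto
  then have "(\<lambda>k. CARD('n) * (l / 2 ^ k)) \<longlonglongrightarrow> 0"
    by (simp add: power_one_over)
  then have "\<forall>\<^sub>F k in sequentially. CARD('n) * (l / 2 ^ k) < \<delta>"
    using \<open>0 < \<delta>\<close> by (rule order_tendstoD(2))
  then obtain K where K: "\<And>k. k \<ge> K \<Longrightarrow> CARD('n) * (l / 2 ^ k) < \<delta>"
    by (auto simp: eventually_sequentially)
  have "(\<integral>\<^sup>+x\<in>?H. ennreal \<bar>dexp f k a l x - f x\<bar> \<partial>lebesgue) \<le> ennreal e" if "k \<ge> K" for k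
  proof -
    have unif: "\<bar>dexp g k a l x - g x\<bar> \<le> \<eta>" if "x \<in> ?H" for x
    proof (rule dexp_modulus[OF \<open>0 < l\<close> gi that])
      fix u v
      assume uv: "u \<in> ?H" "v \<in> ?H" "\<And>i. \<bar>u $ i - v $ i\<bar> \<le> l / 2 ^ k"
      have "dist u v \<le> (\<Sum>i\<in>UNIV. \<bar>(u - v) $ i\<bar>)"
        unfolding dist_norm by (rule norm_le_l1_cart)
      also have "\<dots> \<le> CARD('n) * (l / 2 ^ k)"
        using uv(3) sum_mono[of "UNIV::'n set" "\<lambda>i. \<bar>(u - v) $ i\<bar>" "\<lambda>_. l / 2 ^ k"] by simp
      also have "\<dots> < \<delta>"
        using K \<open>k \<ge> K\<close> .
      finally show "\<bar>g u - g v\<bar> \<le> \<eta>"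
        using \<delta>[OF subsetD[OF HC uv(1)] subsetD[OF HC uv(2)]] by (simp add: dist_real_def)
    qed (use \<open>0 < \<eta>\<close> in simp)
    have m1: "(\<lambda>x. ennreal \<bar>dexp f k a l x - dexp g k a l x\<bar> * indicator ?H x) \<in> borel_measurable lebesgue"
      by measurable
    have m3: "(\<lambda>x. ennreal \<bar>f x - g x\<bar> * indicator ?H x) \<in> borel_measurable lebesgue"
      using f gi by (rule measurable_set_abs_diff)
    have "(\<integral>\<^sup>+x\<in>?H. ennreal \<bar>dexp f k a l x - f x\<bar> \<partial>lebesgue)
        \<le> (\<integral>\<^sup>+x. ennreal \<bar>dexp f k a l x - dexp g k a l x\<bar> * indicator ?H x
            + (ennreal \<eta> * indicator ?H x + ennreal \<bar>f x - g x\<bar> * indicator ?H x) \<partial>lebesgue)"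
    proof (intro nn_integral_mono)
      fix x
      show "ennreal \<bar>dexp f k a l x - f x\<bar> * indicator ?H x
        \<le> ennreal \<bar>dexp f k a l x - dexp g k a l x\<bar> * indicator ?H x
            + (ennreal \<eta> * indicator ?H x + ennreal \<bar>f x - g x\<bar> * indicator ?H x)"
      proof (cases "x \<in> ?H")
        case True
        then show ?thesis
          using unif[OF True] \<open>0 < \<eta>\<close> by (auto simp flip: ennreal_plus intro!: ennreal_leI)
      qed simp
    qed
    also have "\<dots> = (\<integral>\<^sup>+x\<in>?H. ennreal \<bar>dexp f k a l x - dexp g k a l x\<bar> \<partial>lebesgue)
        + ((\<integral>\<^sup>+x\<in>?H. ennreal \<eta> \<partial>lebesgue) + (\<integral>\<^sup>+x\<in>?H. ennreal \<bar>f x - g x\<bar> \<partial>lebesgue))"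
      using m1 m3 by (subst nn_integral_add, (auto)[2], subst nn_integral_add) (auto simp: sets_hcube)
    also have "\<dots> \<le> ennreal (e / 3) + (ennreal (e / 3) + ennreal (e / 3))"
    proof (intro add_mono fg)
      show "(\<integral>\<^sup>+x\<in>?H. ennreal \<bar>dexp f k a l x - dexp g k a l x\<bar> \<partial>lebesgue) \<le> ennreal (e / 3)"
        using dexp_contraction[OF \<open>0 < l\<close> f gi] fg by (rule order_trans)
      show "(\<integral>\<^sup>+x\<in>?H. ennreal \<eta> \<partial>lebesgue) \<le> ennreal (e / 3)"
        using \<open>0 < l\<close> \<open>0 < \<eta>\<close> by (subst set_nn_integral_const_hcube) (auto simp: \<eta>_def)
    qed
    also have "\<dots> = ennreal e"
      using \<open>0 < e\<close> by (simp flip: ennreal_plus)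
    finally show ?thesis .
  qed
  then show ?thesis by blast
qed

text \<open>L^1 convergence yields a subsequence converging almost everywhere on the cube;
  continuity of \<open>h\<close> passes this on to the integrands, and Fatou's lemma carries the
  uniform bound \<open>C\<close> to the limit.\<close>

lemma set_nn_integral_le_if_dexp_le:
  fixes a :: "real^'n" and h :: "real \<Rightarrow> real"
  assumes "0 < l" and f: "set_integrable lebesgue (hcube a l) f" and h: "continuous_on UNIV h"
    and le: "\<And>k. (\<integral>\<^sup>+x\<in>hcube a l. ennreal (h (dexp f k a l x)) \<partial>lebesgue) \<le> C"
  shows "(\<integral>\<^sup>+x\<in>hcube a l. ennreal (h (f x)) \<partial>lebesgue) \<le> C"
proof -
  let ?H = "hcube a l"
  obtain K0 where K0: "\<And>k. k \<ge> K0 \<Longrightarrow> (\<integral>\<^sup>+x\<in>?H. ennreal \<bar>dexp f k a l x - f x\<bar> \<partial>lebesgue) \<le> ennreal 1"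
    using dexp_L1_limit[OF \<open>0 < l\<close> f, of 1] by auto
  \<comment> \<open>The shift by \<open>K0\<close> makes every term of the sequence integrable, its
    L^1 norm being at most 1.\<close>
  define u where "u k x = indicator ?H x *\<^sub>R dexp f (k + K0) a l x - indicator ?H x *\<^sub>R f x" for k x
  have fm: "(\<lambda>x. indicator ?H x *\<^sub>R f x) \<in> borel_measurable lebesgue"
    using f unfolding set_integrable_def by auto
  have um: "u k \<in> borel_measurable lebesgue" for k
    unfolding u_def using fm by (intro borel_measurable_diff) (auto simp: sets_hcube)
  have nu: "(\<integral>\<^sup>+x. ennreal (norm (u k x)) \<partial>lebesgue)
      = (\<integral>\<^sup>+x\<in>?H. ennreal \<bar>dexp f (k + K0) a l x - f x\<bar> \<partial>lebesgue)" for k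
    by (intro nn_integral_cong) (auto simp: u_def indicator_def)
  have int: "integrable lebesgue (u k)" for k
  proof (rule integrableI_bounded[OF um])
    show "(\<integral>\<^sup>+x. ennreal (norm (u k x)) \<partial>lebesgue) < \<infinity>"
      unfolding nu infinity_ennreal_def by (rule le_less_trans[OF K0]) auto
  qed
  have "(\<lambda>k. \<integral>x. norm (u k x) \<partial>lebesgue) \<longlonglongrightarrow> 0"
  proof (rule LIMSEQ_I)
    fix e :: real assume "0 < e"
    then obtain K where K: "\<And>k. k \<ge> K \<Longrightarrow> (\<integral>\<^sup>+x\<in>?H. ennreal \<bar>dexp f k a l x - f x\<bar> \<partial>lebesgue) \<le> ennreal (e / 2)"
      using dexp_L1_limit[OF \<open>0 < l\<close> f, of "e / 2"] by auto
    have "norm ((\<integral>x. norm (u k x) \<partial>lebesgue) - 0) < e" if "k \<ge> K" for k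
    proof -
      have "ennreal (\<integral>x. norm (u k x) \<partial>lebesgue) = (\<integral>\<^sup>+x. ennreal (norm (u k x)) \<partial>lebesgue)"
        using int by (intro nn_integral_eq_integral[symmetric]) auto
      also have "\<dots> \<le> ennreal (e / 2)"
        unfolding nu using K that by simp
      finally have "(\<integral>x. norm (u k x) \<partial>lebesgue) \<le> e / 2"
        using \<open>0 < e\<close> by (simp add: ennreal_le_iff)
      moreover have "0 \<le> (\<integral>x. norm (u k x) \<partial>lebesgue)"
        by simp
      ultimately show ?thesis
        using \<open>0 < e\<close> by simp
    qed
    then show "\<exists>K. \<forall>k\<ge>K. norm ((\<integral>x. norm (u k x) \<partial>lebesgue) - 0) < e"
      by blast
  qed
  from tendsto_L1_AE_subseq[OF int this]
  obtain r where "AE x in lebesgue. (\<lambda>k. u (r k) x) \<longlonglongrightarrow> 0"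
    by auto
  then have "AE x in lebesgue. ennreal (h (f x)) * indicator ?H x
      = liminf (\<lambda>k. ennreal (h (dexp f (r k + K0) a l x)) * indicator ?H x)"
  proof eventually_elim
    case (elim x)
    show ?case
    proof (cases "x \<in> ?H")
      case True
      then have "(\<lambda>k. dexp f (r k + K0) a l x - f x) \<longlonglongrightarrow> 0"
        using elim by (simp add: u_def)
      then have "(\<lambda>k. dexp f (r k + K0) a l x) \<longlonglongrightarrow> f x"
        by (simp add: LIM_zero_iff)
      then have "(\<lambda>k. h (dexp f (r k + K0) a l x)) \<longlonglongrightarrow> h (f x)"
        using h by (intro continuous_on_tendsto_compose[OF h]) auto
      then have "(\<lambda>k. ennreal (h (dexp f (r k + K0) a l x)) * indicator ?H x) \<longlonglongrightarrow> ennreal (h (f x)) * indicator ?H x"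
        using True by (simp add: tendsto_ennrealI)
      then show ?thesis
        by (intro lim_imp_Liminf[symmetric]) auto
    qed (simp add: Liminf_const)
  qed
  then have "(\<integral>\<^sup>+x\<in>?H. ennreal (h (f x)) \<partial>lebesgue)
      = (\<integral>\<^sup>+x. liminf (\<lambda>k. ennreal (h (dexp f (r k + K0) a l x)) * indicator ?H x) \<partial>lebesgue)"
    by (rule nn_integral_cong_AE)
  also have "\<dots> \<le> liminf (\<lambda>k. \<integral>\<^sup>+x\<in>?H. ennreal (h (dexp f (r k + K0) a l x)) \<partial>lebesgue)"
  proof (rule nn_integral_liminf)
    have [measurable]: "h \<in> borel_measurable borel"
      using h by (rule borel_measurable_continuous_onI)
    show "(\<lambda>x. ennreal (h (dexp f (r k + K0) a l x)) * indicator ?H x) \<in> borel_measurable lebesgue" for k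
      by measurable
  qed
  also have "\<dots> \<le> liminf (\<lambda>k. C)"
    by (intro Liminf_mono always_eventually allI le)
  finally show ?thesis
    by (simp add: Liminf_const)
qed

section \<open>Oscillation bounds and the stopping argument\<close>

text \<open>Mean oscillation at most \<open>B\<close> on all subcubes, with the volume multiplied
  out. Ranging over every subcube makes the condition pass to the dyadic children.\<close>

definition osc_le :: "(real^'n \<Rightarrow> real) \<Rightarrow> real \<Rightarrow> real^'n \<Rightarrow> real \<Rightarrow> bool" where
  "osc_le f B a l \<longleftrightarrow> set_integrable lebesgue (hcube a l) f \<and>
     (\<forall>a' l'. 0 < l' \<longrightarrow> hcube a' l' \<subseteq> hcube a l \<longrightarrow>
       (\<integral>\<^sup>+x\<in>hcube a' l'. ennreal \<bar>f x - avg f a' l'\<bar> \<partial>lebesgue) \<le> ennreal (B * l' ^ CARD('n)))"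

lemma osc_le_corner:
  assumes "0 < l" "osc_le f B a l"
  shows "osc_le f B (corner a l s) (l / 2)"
  using assms hcube_corner_subset[OF assms(1), of a s] set_integrable_corner[OF assms(1)]
  unfolding osc_le_def by (meson order_trans)

text \<open>The oscillation integral over the child is at most that over the parent, while the
  volume drops by the factor 2^n.\<close>

lemma avg_corner_jump:
  fixes a :: "real^'n"
  assumes "0 < l" "osc_le f B a l" "0 \<le> B"
  shows "\<bar>avg f (corner a l s) (l / 2) - avg f a l\<bar> \<le> 2 ^ CARD('n) * B"
proof -
  let ?c = "corner a l s"
  have "ennreal (\<bar>avg f ?c (l / 2) - avg f a l\<bar> * (l / 2) ^ CARD('n))
      \<le> (\<integral>\<^sup>+x\<in>hcube ?c (l / 2). ennreal \<bar>f x - avg f a l\<bar> \<partial>lebesgue)"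
    using assms by (intro avg_diff_const_le set_integrable_corner) (auto simp: osc_le_def)
  also have "\<dots> \<le> (\<integral>\<^sup>+x\<in>hcube a l. ennreal \<bar>f x - avg f a l\<bar> \<partial>lebesgue)"
    using hcube_corner_subset[OF assms(1), of a s]
    by (intro nn_integral_mono mult_left_mono) (auto simp: indicator_def)
  also have "\<dots> \<le> ennreal (B * l ^ CARD('n))"
    using assms by (auto simp: osc_le_def)
  finally have "\<bar>avg f ?c (l / 2) - avg f a l\<bar> * (l / 2) ^ CARD('n) \<le> B * l ^ CARD('n)"
    using assms by (simp add: ennreal_le_iff)
  then show ?thesis
    using assms by (simp add: power_divide field_simps)
qed

text \<open>The triangle inequality in the exponent: the price of moving the centre from
  \<open>c\<close> to \<open>d\<close>. It is used on a stopped cube, with \<open>d\<close> its own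
  average.\<close>

lemma exp_dexp_shift:
  fixes a :: "real^'n"
  assumes "0 \<le> r"
  shows "(\<integral>\<^sup>+x\<in>hcube a l. ennreal (exp (r * \<bar>dexp f k a l x - c\<bar>)) \<partial>lebesgue)
    \<le> ennreal (exp (r * \<bar>d - c\<bar>)) * (\<integral>\<^sup>+x\<in>hcube a l. ennreal (exp (r * \<bar>dexp f k a l x - d\<bar>)) \<partial>lebesgue)"
proof -
  have "exp (r * \<bar>t - c\<bar>) \<le> exp (r * \<bar>d - c\<bar>) * exp (r * \<bar>t - d\<bar>)" for t
  proof -
    have "r * \<bar>t - c\<bar> \<le> r * (\<bar>d - c\<bar> + \<bar>t - d\<bar>)"
      using assms by (intro mult_left_mono) auto
    then show ?thesis by (simp add: distrib_left flip: exp_add)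
  qed
  then have "(\<integral>\<^sup>+x\<in>hcube a l. ennreal (exp (r * \<bar>dexp f k a l x - c\<bar>)) \<partial>lebesgue)
    \<le> (\<integral>\<^sup>+x. ennreal (exp (r * \<bar>d - c\<bar>)) * (ennreal (exp (r * \<bar>dexp f k a l x - d\<bar>)) * indicator (hcube a l) x) \<partial>lebesgue)"
    by (intro nn_integral_mono) (auto simp: indicator_def ennreal_mult[symmetric] intro!: ennreal_leI)
  also have "\<dots> = ennreal (exp (r * \<bar>d - c\<bar>)) * (\<integral>\<^sup>+x\<in>hcube a l. ennreal (exp (r * \<bar>dexp f k a l x - d\<bar>)) \<partial>lebesgue)"
    by (rule nn_integral_cmult) measurable
  finally show ?thesis .
qed

text \<open>The mean is at most 3/2 + 9/2 = 6. The constants reproduce themselves in the induction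
  below: 3/2 covers a cube at generation 0, and 9 = 3/2 * 6 is the cost of a stopped cube per unit
  of volume.\<close>

lemma osc_le_affine:
  fixes a :: "real^'n"
  assumes "0 < B" "0 < l" and f: "osc_le f B a l"
  shows "(\<integral>\<^sup>+x\<in>hcube a l. ennreal (3 / 2 + 9 / (2 * B) * \<bar>f x - avg f a l\<bar>) \<partial>lebesgue) \<le> ennreal (6 * l ^ CARD('n))"
proof -
  let ?H = "hcube a l" and ?m = "avg f a l"
  have m: "(\<lambda>x. ennreal \<bar>f x - ?m\<bar> * indicator ?H x) \<in> borel_measurable lebesgue"
    using f by (intro measurable_set_compose) (auto simp: osc_le_def)
  have "(\<integral>\<^sup>+x\<in>?H. ennreal (3 / 2 + 9 / (2 * B) * \<bar>f x - ?m\<bar>) \<partial>lebesgue)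
      = (\<integral>\<^sup>+x. ennreal (3 / 2) * indicator ?H x + ennreal (9 / (2 * B)) * (ennreal \<bar>f x - ?m\<bar> * indicator ?H x) \<partial>lebesgue)"
    using \<open>0 < B\<close> by (intro nn_integral_cong) (auto simp: indicator_def ennreal_mult[symmetric])
  also have "\<dots> = (\<integral>\<^sup>+x\<in>?H. ennreal (3 / 2) \<partial>lebesgue)
      + ennreal (9 / (2 * B)) * (\<integral>\<^sup>+x\<in>?H. ennreal \<bar>f x - ?m\<bar> \<partial>lebesgue)"
    using m by (subst nn_integral_add) (auto simp: sets_hcube nn_integral_cmult)
  also have "\<dots> \<le> ennreal (3 / 2 * l ^ CARD('n)) + ennreal (9 / (2 * B)) * ennreal (B * l ^ CARD('n))"
    using assms by (intro add_mono mult_left_mono) (auto simp: osc_le_def set_nn_integral_const_hcube simp del: nn_integral_indicator)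
  also have "\<dots> = ennreal (6 * l ^ CARD('n))"
    using assms by (simp add: ennreal_mult[symmetric] flip: ennreal_plus)
  finally show ?thesis .
qed

text \<open>Writing the bound as an integral over the cube makes both sides additive over the dyadic children,
  so the induction step only compares them child by child.\<close>

lemma exp_dexp_stopping:
  fixes a :: "real^'n"
  assumes "0 < B" and r: "r = ln (3 / 2) / ((2 + 2 ^ CARD('n)) * B)"
    and "0 < l" "osc_le f B a l" "\<bar>avg f a l - c\<bar> \<le> 2 * B"
  shows "(\<integral>\<^sup>+x\<in>hcube a l. ennreal (exp (r * \<bar>dexp f k a l x - c\<bar>)) \<partial>lebesgue)
    \<le> (\<integral>\<^sup>+x\<in>hcube a l. ennreal (3 / 2 + 9 / (2 * B) * \<bar>f x - c\<bar>) \<partial>lebesgue)"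
proof -
  have pos: "0 < (2 + 2 ^ CARD('n)) * B"
    using \<open>0 < B\<close> by (simp add: add_pos_pos)
  have "0 \<le> r"
    using pos unfolding r by (intro divide_nonneg_pos) auto
  have exp_le: "exp (r * t) \<le> 3 / 2" if "t \<le> (2 + 2 ^ CARD('n)) * B" for t
  proof -
    have "r * t \<le> r * ((2 + 2 ^ CARD('n)) * B)"
      using that \<open>0 \<le> r\<close> by (rule mult_left_mono)
    also have "\<dots> = ln (3 / 2)"
      using r pos by (metis eq_divide_eq less_irrefl)
    finally show ?thesis
      by (metis exp_le_cancel_iff exp_ln zero_less_divide_iff zero_less_numeral)
  qed
  \<comment> \<open>The centre \<open>c\<close> is generalized: a child whose average stays in the
    window keeps \<open>c\<close>, while a stopped child restarts with its own average, for which
    the window condition is trivial.\<close>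
  show ?thesis
    using assms(3-)
  proof (induction k arbitrary: a l c)
    case (0 a l c)
    \<comment> \<open>At generation 0 the average is still in the window, so the summand 3/2 alone
      dominates the exponential.\<close>
    have "2 * B \<le> (2 + 2 ^ CARD('n)) * B"
      using \<open>0 < B\<close> by (intro mult_right_mono) auto
    then have "exp (r * \<bar>avg f a l - c\<bar>) \<le> 3 / 2"
      using 0(3) by (intro exp_le) linarith
    then have "exp (r * \<bar>avg f a l - c\<bar>) \<le> 3 / 2 + 9 / (2 * B) * \<bar>f x - c\<bar>" for x
      using \<open>0 < B\<close> by (smt (verit) divide_nonneg_pos mult_nonneg_nonneg)
    then show ?case
      by (intro nn_integral_mono mult_right_mono) (auto intro: ennreal_leI)
  next
    case (Suc k a l c)
    let ?J = "\<lambda>k a l c. \<integral>\<^sup>+x\<in>hcube a l. ennreal (exp (r * \<bar>dexp f k a l x - c\<bar>)) \<partial>lebesgue"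
    let ?R = "\<lambda>a l c. \<integral>\<^sup>+x\<in>hcube a l. ennreal (3 / 2 + 9 / (2 * B) * \<bar>f x - c\<bar>) \<partial>lebesgue"
    have f: "set_integrable lebesgue (hcube a l) f"
      using Suc.prems by (simp add: osc_le_def)
    have child: "?J k (corner a l s) (l / 2) c \<le> ?R (corner a l s) (l / 2) c" for s
    proof -
      let ?a = "corner a l s" and ?l = "l / 2"
      define d where "d = avg f ?a ?l"
      have osc: "osc_le f B ?a ?l"
        using Suc.prems by (intro osc_le_corner)
      have "0 < ?l"
        using Suc.prems by simp
      show ?thesis
      proof (cases "\<bar>d - c\<bar> \<le> 2 * B")
        case True
        then show ?thesis
          unfolding d_def by (rule Suc.IH[OF \<open>0 < ?l\<close> osc])
      next
        case False
        have "\<bar>d - avg f a l\<bar> \<le> 2 ^ CARD('n) * B"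
          unfolding d_def using Suc.prems \<open>0 < B\<close> by (intro avg_corner_jump) auto
        \<comment> \<open>The parent's average is still in the window, so the overshoot on stopping
          is at most one jump.\<close>
        then have "\<bar>d - c\<bar> \<le> (2 + 2 ^ CARD('n)) * B"
          using Suc.prems(3) by (simp add: distrib_right)
        have "?J k ?a ?l c \<le> ennreal (exp (r * \<bar>d - c\<bar>)) * ?J k ?a ?l d"
          using \<open>0 \<le> r\<close> by (rule exp_dexp_shift)
        also have "\<dots> \<le> ennreal (3 / 2) * ennreal (6 * ?l ^ CARD('n))"
        proof (rule mult_mono)
          show "ennreal (exp (r * \<bar>d - c\<bar>)) \<le> ennreal (3 / 2)"
            using exp_le[OF \<open>\<bar>d - c\<bar> \<le> _\<close>] by (rule ennreal_leI)
          have "?J k ?a ?l d \<le> ?R ?a ?l d"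
            using \<open>0 < B\<close> by (intro Suc.IH[OF \<open>0 < ?l\<close> osc]) (simp add: d_def)
          also have "\<dots> \<le> ennreal (6 * ?l ^ CARD('n))"
            unfolding d_def by (rule osc_le_affine[OF \<open>0 < B\<close> \<open>0 < ?l\<close> osc])
          finally show "?J k ?a ?l d \<le> ennreal (6 * ?l ^ CARD('n))" .
        qed auto
        also have "\<dots> = ennreal (9 * ?l ^ CARD('n))"
          using Suc.prems by (subst ennreal_mult[symmetric]) auto
        \<comment> \<open>Chebyshev on this child: outside the window,
          \<open>\<bar>d - c\<bar>\<close> exceeds \<open>2 * B\<close>, so the constant 9 is
          absorbed by \<open>9 / (2 * B) * \<bar>d - c\<bar>\<close>, which is then bounded by the
          integral of \<open>\<bar>f x - c\<bar>\<close>.\<close>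
        also have "\<dots> \<le> ennreal (9 / (2 * B) * (\<bar>d - c\<bar> * ?l ^ CARD('n)))"
        proof (rule ennreal_leI)
          have "2 * B * ?l ^ CARD('n) \<le> \<bar>d - c\<bar> * ?l ^ CARD('n)"
            using False Suc.prems by (intro mult_right_mono) auto
          then show "9 * ?l ^ CARD('n) \<le> 9 / (2 * B) * (\<bar>d - c\<bar> * ?l ^ CARD('n))"
            using \<open>0 < B\<close> by (simp add: pos_le_divide_eq mult_ac)
        qed
        also have "\<dots> = ennreal (9 / (2 * B)) * ennreal (\<bar>d - c\<bar> * ?l ^ CARD('n))"
          using \<open>0 < B\<close> Suc.prems by (intro ennreal_mult) auto
        also have "\<dots> \<le> ennreal (9 / (2 * B)) * (\<integral>\<^sup>+x\<in>hcube ?a ?l. ennreal \<bar>f x - c\<bar> \<partial>lebesgue)"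
          unfolding d_def using osc \<open>0 < ?l\<close> by (intro mult_left_mono avg_diff_const_le) (auto simp: osc_le_def)
        also have "\<dots> = (\<integral>\<^sup>+x. ennreal (9 / (2 * B)) * (ennreal \<bar>f x - c\<bar> * indicator (hcube ?a ?l) x) \<partial>lebesgue)"
          using osc by (intro nn_integral_cmult[symmetric] measurable_set_compose) (auto simp: osc_le_def)
        also have "\<dots> \<le> ?R ?a ?l c"
          using \<open>0 < B\<close> by (intro nn_integral_mono) (auto simp: indicator_def ennreal_mult[symmetric] intro!: ennreal_leI)
        finally show ?thesis .
      qed
    qed
    have "?J (Suc k) a l c = (\<Sum>s\<in>UNIV. \<integral>\<^sup>+x\<in>hcube (corner a l s) (l / 2). ennreal (exp (r * \<bar>dexp f (Suc k) a l x - c\<bar>)) \<partial>lebesgue)"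
      by (rule set_nn_integral_hcube_corner[OF Suc.prems(1)]) measurable
    also have "\<dots> = (\<Sum>s\<in>UNIV. ?J k (corner a l s) (l / 2) c)"
      by (intro sum.cong nn_integral_cong) (auto simp: indicator_def dexp_Suc_corner[OF Suc.prems(1)] simp del: dexp.simps)
    also have "\<dots> \<le> (\<Sum>s\<in>UNIV. ?R (corner a l s) (l / 2) c)"
      by (intro sum_mono child)
    also have "\<dots> = ?R a l c"
      using f by (intro set_nn_integral_hcube_corner[symmetric, OF Suc.prems(1)] measurable_set_compose) auto
    finally show ?case .
  qed
qed

section \<open>From exponential integrability to q-th powers\<close>

text \<open>Raise x <= exp x, taken at x = t / q, to the power \<open>q\<close>.\<close>

lemma powr_le_exp:
  fixes t q :: real
  assumes "0 \<le> t" "0 < q"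
  shows "t powr q \<le> q powr q * exp t"
proof -
  have "t / q \<le> exp (t / q)"
    using exp_ge_add_one_self[of "t / q"] by linarith
  then have "(t / q) powr q \<le> exp (t / q) powr q"
    using assms by (intro powr_mono2) auto
  then have "t powr q / q powr q \<le> exp t"
    using assms by (simp add: powr_divide exp_powr_real)
  then show ?thesis
    using assms by (simp add: divide_le_eq mult.commute)
qed

text \<open>With \<open>r\<close> the exponential rate for \<open>B\<close>, this is the q-th root
  of \<open>6 * (q / r) powr q\<close> divided by \<open>B\<close>. As \<open>r * B\<close> depends
  only on the dimension, \<open>B\<close> cancels.\<close>

definition JN_const :: "nat \<Rightarrow> real \<Rightarrow> real" where
  "JN_const n q = 6 powr (1 / q) * q * (2 + 2 ^ n) / ln (3 / 2)"

lemma JN_const_nonneg: "0 \<le> q \<Longrightarrow> 0 \<le> JN_const n q"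
  by (auto simp: JN_const_def intro!: divide_nonneg_pos)

text \<open>Centred at the cube's own average, the stopping estimate gives the exponential a mean of
  at most 6 at every generation, hence also for \<open>f\<close>; the q-th power is at most
  \<open>(q / r) powr q\<close> times that exponential.\<close>

lemma John_Nirenberg:
  fixes a :: "real^'n"
  assumes "0 < B" "0 < l" "osc_le f B a l" "0 < q"
  shows "(\<integral>\<^sup>+x\<in>hcube a l. ennreal (\<bar>f x - avg f a l\<bar> powr q) \<partial>lebesgue)
    \<le> ennreal ((JN_const CARD('n) q * B) powr q * l ^ CARD('n))"
proof -
  define r where "r = ln (3 / 2) / ((2 + 2 ^ CARD('n)) * B)"
  have "0 < r"
    using \<open>0 < B\<close> unfolding r_def by (intro divide_pos_pos mult_pos_pos) (auto simp: add_pos_pos)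
  let ?h = "\<lambda>t. exp (r * \<bar>t - avg f a l\<bar>)"
  have f: "set_integrable lebesgue (hcube a l) f"
    using assms by (simp add: osc_le_def)
  have "(\<integral>\<^sup>+x\<in>hcube a l. ennreal (?h (dexp f k a l x)) \<partial>lebesgue) \<le> ennreal (6 * l ^ CARD('n))" for k
    using exp_dexp_stopping[OF \<open>0 < B\<close> r_def \<open>0 < l\<close> \<open>osc_le f B a l\<close>, of "avg f a l" k]
      osc_le_affine[OF assms(1-3)] \<open>0 < B\<close> by simp
  then have exp6: "(\<integral>\<^sup>+x\<in>hcube a l. ennreal (?h (f x)) \<partial>lebesgue) \<le> ennreal (6 * l ^ CARD('n))"
    by (intro set_nn_integral_le_if_dexp_le[OF \<open>0 < l\<close> f, of ?h] continuous_intros)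
  have pw: "t powr q \<le> (q / r) powr q * exp (r * t)" if "0 \<le> t" for t
  proof -
    have "r powr q * t powr q \<le> q powr q * exp (r * t)"
      using powr_le_exp[of "r * t" q] that \<open>0 < r\<close> \<open>0 < q\<close> by (simp add: powr_mult)
    then show ?thesis
      using \<open>0 < r\<close> \<open>0 < q\<close> by (simp add: powr_divide field_simps)
  qed
  have "(\<integral>\<^sup>+x\<in>hcube a l. ennreal (\<bar>f x - avg f a l\<bar> powr q) \<partial>lebesgue)
      \<le> (\<integral>\<^sup>+x. ennreal ((q / r) powr q) * (ennreal (?h (f x)) * indicator (hcube a l) x) \<partial>lebesgue)"
    using pw by (intro nn_integral_mono) (auto simp: indicator_def ennreal_mult[symmetric] intro!: ennreal_leI)
  also have "\<dots> = ennreal ((q / r) powr q) * (\<integral>\<^sup>+x\<in>hcube a l. ennreal (?h (f x)) \<partial>lebesgue)"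
    by (intro nn_integral_cmult measurable_set_compose[OF f]) auto
  also have "\<dots> \<le> ennreal ((q / r) powr q) * ennreal (6 * l ^ CARD('n))"
    by (intro mult_left_mono exp6) auto
  also have "\<dots> = ennreal ((q / r) powr q * 6 * l ^ CARD('n))"
    using \<open>0 < l\<close> by (simp add: ennreal_mult mult.assoc)
  also have "(q / r) powr q * 6 = (JN_const CARD('n) q * B) powr q"
  proof -
    have "JN_const CARD('n) q * B = 6 powr (1 / q) * (q / r)"
      using \<open>0 < B\<close> by (simp add: JN_const_def r_def)
    then show ?thesis
      using \<open>0 < q\<close> \<open>0 < r\<close> by (simp add: powr_mult powr_divide powr_powr)
  qed
  finally show ?thesis .
qed

section \<open>Jensen's inequality for the lower bound\<close>

text \<open>The concave function s powr (1/q) lies below its tangent at s = m powr q. With s the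
  q-th power of \<open>\<bar>f x - c\<bar>\<close>, integrating this affine bound gives Jensen's
  inequality.\<close>

lemma set_nn_integral_le_powr:
  fixes a :: "real^'n"
  assumes "0 < l" "1 < q" "0 < m" and f: "set_integrable lebesgue (hcube a l) f"
    and le: "(\<integral>\<^sup>+x\<in>hcube a l. ennreal (\<bar>f x - c\<bar> powr q) \<partial>lebesgue) \<le> ennreal (m powr q * l ^ CARD('n))"
  shows "(\<integral>\<^sup>+x\<in>hcube a l. ennreal \<bar>f x - c\<bar> \<partial>lebesgue) \<le> ennreal (m * l ^ CARD('n))"
proof -
  let ?H = "hcube a l"
  define u where "u = m * (1 - 1 / q)"
  \<comment> \<open>\<open>u\<close> and \<open>v\<close> are the intercept and the slope of that
    tangent, so \<open>u + v * m powr q = m\<close>.\<close>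
  define v where "v = m / q / m powr q"
  have "0 \<le> u" "0 \<le> v"
    using assms by (auto simp: u_def v_def)
  have young: "t \<le> u + v * t powr q" if "0 \<le> t" for t
  proof -
    \<comment> \<open>Young's inequality with second factor 1 and conjugate exponent q / (q - 1) is
      the tangent bound, rescaled by \<open>m\<close>.\<close>
    have "t / m * 1 \<le> (t / m) powr q / q + 1 powr (q / (q - 1)) / (q / (q - 1))"
      using that assms by (intro Youngs_inequality) (auto simp: field_simps)
    then have "t / m \<le> t powr q / m powr q / q + (1 - 1 / q)"
      using that assms by (simp add: powr_divide diff_divide_distrib)
    then have "m * (t / m) \<le> m * (t powr q / m powr q / q + (1 - 1 / q))"
      using assms by (intro mult_left_mono) auto
    then show ?thesis
      using assms by (simp add: u_def v_def algebra_simps)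
  qed
  have m: "(\<lambda>x. ennreal (\<bar>f x - c\<bar> powr q) * indicator ?H x) \<in> borel_measurable lebesgue"
    by (intro measurable_set_compose[OF f]) auto
  have "(\<integral>\<^sup>+x\<in>?H. ennreal \<bar>f x - c\<bar> \<partial>lebesgue)
      \<le> (\<integral>\<^sup>+x. ennreal u * indicator ?H x + ennreal v * (ennreal (\<bar>f x - c\<bar> powr q) * indicator ?H x) \<partial>lebesgue)"
    using young \<open>0 \<le> u\<close> \<open>0 \<le> v\<close>
    by (intro nn_integral_mono) (auto simp: indicator_def ennreal_mult[symmetric] simp flip: ennreal_plus intro!: ennreal_leI)
  also have "\<dots> = (\<integral>\<^sup>+x\<in>?H. ennreal u \<partial>lebesgue)
      + ennreal v * (\<integral>\<^sup>+x\<in>?H. ennreal (\<bar>f x - c\<bar> powr q) \<partial>lebesgue)"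
    using m by (subst nn_integral_add) (auto simp: sets_hcube nn_integral_cmult)
  also have "\<dots> \<le> ennreal (u * l ^ CARD('n)) + ennreal v * ennreal (m powr q * l ^ CARD('n))"
    using le \<open>0 \<le> u\<close> \<open>0 < l\<close>
    by (intro add_mono mult_left_mono) (auto simp: set_nn_integral_const_hcube simp del: nn_integral_indicator)
  also have "\<dots> = ennreal ((u + v * m powr q) * l ^ CARD('n))"
    using \<open>0 \<le> u\<close> \<open>0 \<le> v\<close> \<open>0 < l\<close> by (simp add: ennreal_mult[symmetric] distrib_right mult.assoc flip: ennreal_plus)
  also have "u + v * m powr q = m"
    using assms by (simp add: u_def v_def algebra_simps)
  finally show ?thesis .
qed

section \<open>Translation from cubes compactly inside V\<close>

text \<open>The compact set between the cube and \<open>V\<close> is closed, hence contains the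
  closure of the cube, which is the closed box because the open one is nonempty.\<close>

lemma cubes_in_cases:
  assumes "Q \<in> cubes_in V"
  obtains a l where "0 < l" "Q = box a (\<chi> i. a $ i + l)" "cbox a (\<chi> i. a $ i + l) \<subseteq> V"
proof -
  obtain a l K where l: "0 < l" "Q = box a (\<chi> i. a $ i + l)" and K: "compact K" "K \<subseteq> V" "Q \<subseteq> K"
    using assms by (auto simp: cubes_in_def open_cube_def compactly_inside_def)
  have "box a (\<chi> i. a $ i + l) \<noteq> {}"
    using l by (simp add: interval_ne_empty_cart)
  then have "cbox a (\<chi> i. a $ i + l) = closure Q"
    using l by (simp add: closure_box)
  also have "\<dots> \<subseteq> V"
    using K by (meson closure_minimal compact_imp_closed order_trans)
  finally show ?thesis
    using l that by blast
qed

lemma box_in_cubes_in: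
  assumes "0 < l" "cbox a (\<chi> i. a $ i + l) \<subseteq> V"
  shows "box a (\<chi> i. a $ i + l) \<in> cubes_in V"
  unfolding cubes_in_def open_cube_def compactly_inside_def mem_Collect_eq
proof (intro conjI exI)
  show "compact (cbox a (\<chi> i. a $ i + l))" "box a (\<chi> i. a $ i + l) \<subseteq> cbox a (\<chi> i. a $ i + l)"
    by (rule compact_cbox, rule box_subset_cbox)
qed (use assms in auto)

lemma hcube_subset_cbox: "hcube a l \<subseteq> cbox a (\<chi> i. a $ i + l)"
  by (auto simp: hcube_def mem_box_cart less_imp_le)

lemma box_subset_hcube: "box a (\<chi> i. a $ i + l) \<subseteq> hcube a l"
  by (auto simp: hcube_def mem_box_cart less_imp_le)

lemma set_integrable_hcube_L1_loc:
  assumes "f \<in> L1_loc V" "cbox a (\<chi> i. a $ i + l) \<subseteq> V"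
  shows "set_integrable lebesgue (hcube a l) f"
proof (rule set_integrable_subset)
  show "set_integrable lebesgue (cbox a (\<chi> i. a $ i + l)) f"
    using assms by (simp add: L1_loc_def)
qed (use hcube_subset_cbox in \<open>auto simp: sets_hcube\<close>)

lemma cube_mean_box:
  fixes a :: "real^'n"
  assumes "0 < l" and f: "set_integrable lebesgue (hcube a l) f"
  shows "cube_mean (box a (\<chi> i. a $ i + l)) f = avg f a l"
proof -
  let ?B = "box a (\<chi> i. a $ i + l)"
  have "set_integrable lebesgue ?B f"
    by (rule set_integrable_subset[OF f _ box_subset_hcube]) auto
  then have "(LINT x:?B|lebesgue. f x) = (LINT x:hcube a l|lebesgue. f x)"
    unfolding set_lebesgue_integral_def
  proof (intro integral_cong_AE)
    show "AE x in lebesgue. indicator ?B x *\<^sub>R f x = indicator (hcube a l) x *\<^sub>R f x"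
      by (rule AE_mp[OF AE_box_hcube[of a l]]) (auto simp: indicator_def)
  qed (use f in \<open>auto simp: set_integrable_def\<close>)
  moreover have "measure lebesgue ?B = l ^ CARD('n)"
    using emeasure_box_cube[of l a] assms(1) by (simp add: measure_def)
  ultimately show ?thesis
    by (simp add: cube_mean_def avg_def)
qed

lemma mean_osc_box:
  fixes a :: "real^'n"
  assumes "0 < l" "set_integrable lebesgue (hcube a l) f"
  shows "mean_osc (box a (\<chi> i. a $ i + l)) f
    = (\<integral>\<^sup>+x\<in>hcube a l. ennreal \<bar>f x - avg f a l\<bar> \<partial>lebesgue) / ennreal (l ^ CARD('n))"
  unfolding mean_osc_def cube_mean_box[OF assms] set_nn_integral_box_hcube
  using assms by (subst emeasure_box_cube) auto

lemma mean_osc_power_box: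
  fixes a :: "real^'n"
  assumes "0 < l" "set_integrable lebesgue (hcube a l) f"
  shows "mean_osc_power q (box a (\<chi> i. a $ i + l)) f
    = (\<integral>\<^sup>+x\<in>hcube a l. ennreal (\<bar>f x - avg f a l\<bar> powr q) \<partial>lebesgue) / ennreal (l ^ CARD('n))"
  unfolding mean_osc_power_def cube_mean_box[OF assms] set_nn_integral_box_hcube
  using assms by (subst emeasure_box_cube) auto

lemma divide_ennreal_le_iff:
  assumes "0 < v" "0 \<le> y"
  shows "x / ennreal v \<le> ennreal y \<longleftrightarrow> x \<le> ennreal (y * v)"
proof
  assume "x / ennreal v \<le> ennreal y"
  then have "x / ennreal v * ennreal v \<le> ennreal y * ennreal v"
    by (rule mult_right_mono) simp
  then show "x \<le> ennreal (y * v)"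
    using assms by (simp add: ennreal_mult ennreal_divide_times ennreal_mult_divide_eq)
next
  assume "x \<le> ennreal (y * v)"
  then show "x / ennreal v \<le> ennreal y"
    using assms by (intro divide_le_posI_ennreal) (auto simp: ennreal_mult mult.commute)
qed

text \<open>The seminorm ranges over all cubes compactly inside \<open>V\<close>, and every
  half-open subcube gives one: its closed box stays within the closed box of the large cube.\<close>

lemma osc_le_if_bmo_seminorm_le:
  fixes a :: "real^'n"
  assumes "f \<in> L1_loc V" "cbox a (\<chi> i. a $ i + l) \<subseteq> V" "bmo_seminorm V f \<le> ennreal B" "0 \<le> B"
  shows "osc_le f B a l"
  unfolding osc_le_def
proof (intro conjI allI impI)
  show "set_integrable lebesgue (hcube a l) f"
    using assms by (intro set_integrable_hcube_L1_loc)
  fix a' :: "real^'n" and l' :: real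
  assume "0 < l'" and sub: "hcube a' l' \<subseteq> hcube a l"
  have ne: "box a' (\<chi> i. a' $ i + l') \<noteq> {}"
    using \<open>0 < l'\<close> by (simp add: interval_ne_empty_cart)
  have "box a' (\<chi> i. a' $ i + l') \<subseteq> cbox a (\<chi> i. a $ i + l)"
    using box_subset_hcube sub hcube_subset_cbox by blast
  then have "cbox a' (\<chi> i. a' $ i + l') \<subseteq> cbox a (\<chi> i. a $ i + l)"
    using closure_minimal[OF _ closed_cbox] closure_box[OF ne] by metis
  then have sub': "cbox a' (\<chi> i. a' $ i + l') \<subseteq> V"
    using assms by blast
  have "mean_osc (box a' (\<chi> i. a' $ i + l')) f \<le> ennreal B"
    using SUP_upper[OF box_in_cubes_in[OF \<open>0 < l'\<close> sub']] assms(3)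
    unfolding bmo_seminorm_def by (rule order_trans)
  then show "(\<integral>\<^sup>+x\<in>hcube a' l'. ennreal \<bar>f x - avg f a' l'\<bar> \<partial>lebesgue) \<le> ennreal (B * l' ^ CARD('n))"
    using mean_osc_box[OF \<open>0 < l'\<close> set_integrable_hcube_L1_loc[OF assms(1) sub']] \<open>0 < l'\<close> \<open>0 \<le> B\<close>
    by (simp add: divide_ennreal_le_iff)
qed

section \<open>The two inequalities on one cube, and the theorem\<close>

lemma ennreal_power_le:
  assumes "x \<le> ennreal (y powr q)" "0 \<le> y" "0 < q"
  shows "ennreal_power x (1 / q) \<le> ennreal y"
proof -
  have "x \<noteq> \<infinity>"
    using assms(1) by (auto simp: top_unique)
  have "enn2real x \<le> y powr q"
    using enn2real_mono[OF assms(1)] by simp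
  then have "enn2real x powr (1 / q) \<le> (y powr q) powr (1 / q)"
    using assms by (intro powr_mono2) auto
  then show ?thesis
    using \<open>x \<noteq> \<infinity>\<close> assms by (simp add: ennreal_power_def powr_powr ennreal_leI)
qed

text \<open>If the q-th power mean is infinite there is nothing to prove; otherwise this is Jensen's
  inequality on the half-open cube.\<close>

lemma mean_osc_le_ennreal_power:
  assumes "f \<in> L1_loc V" "Q \<in> cubes_in V" "1 < q"
  shows "mean_osc Q f \<le> ennreal_power (mean_osc_power q Q f) (1 / q)"
proof (cases "mean_osc_power q Q f = \<infinity>")
  case True
  then show ?thesis by (simp add: ennreal_power_def)
next
  case False
  then obtain w where w: "0 \<le> w" "mean_osc_power q Q f = ennreal w"
    by (cases "mean_osc_power q Q f") auto
  obtain a l where l: "0 < l" "Q = box a (\<chi> i. a $ i + l)" "cbox a (\<chi> i. a $ i + l) \<subseteq> V"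
    using cubes_in_cases[OF assms(2)] .
  have f: "set_integrable lebesgue (hcube a l) f"
    using assms(1) l(3) by (rule set_integrable_hcube_L1_loc)
  \<comment> \<open>The mean \<open>w\<close> may be 0, whereas the tangent point has to be
    positive; hence the slack \<open>e\<close>.\<close>
  have "mean_osc Q f \<le> ennreal (w powr (1 / q)) + ennreal e" if "0 < e" for e
  proof -
    let ?m = "w powr (1 / q) + e"
    have "0 < ?m"
      using that by (simp add: add_nonneg_pos)
    have "w = (w powr (1 / q)) powr q"
      using w assms(3) by (simp add: powr_powr)
    also have "\<dots> \<le> ?m powr q"
      using that assms(3) by (intro powr_mono2) auto
    finally have "mean_osc_power q Q f \<le> ennreal (?m powr q)"
      using w by (simp add: ennreal_leI)
    then have "mean_osc Q f \<le> ennreal ?m"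
      using set_nn_integral_le_powr[OF l(1) assms(3) \<open>0 < ?m\<close> f] l(1) \<open>0 < ?m\<close>
      by (simp add: l(2) mean_osc_power_box[OF l(1) f] mean_osc_box[OF l(1) f] divide_ennreal_le_iff)
    then show ?thesis
      using that by (simp add: ennreal_plus)
  qed
  then have "mean_osc Q f \<le> ennreal (w powr (1 / q))"
    by (rule ennreal_le_epsilon)
  then show ?thesis
    using w by (simp add: ennreal_power_def)
qed

lemma ennreal_power_mean_osc_power_le:
  fixes V :: "(real^'n) set"
  assumes "f \<in> L1_loc V" "Q \<in> cubes_in V" "0 < q" "0 < B" "bmo_seminorm V f \<le> ennreal B"
  shows "ennreal_power (mean_osc_power q Q f) (1 / q) \<le> ennreal (JN_const CARD('n) q * B)"
proof -
  obtain a l where l: "0 < l" "Q = box a (\<chi> i. a $ i + l)" "cbox a (\<chi> i. a $ i + l) \<subseteq> V"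
    using cubes_in_cases[OF assms(2)] .
  have f: "set_integrable lebesgue (hcube a l) f"
    using assms(1) l(3) by (rule set_integrable_hcube_L1_loc)
  have "osc_le f B a l"
    using assms l(3) by (intro osc_le_if_bmo_seminorm_le) auto
  from John_Nirenberg[OF \<open>0 < B\<close> l(1) this \<open>0 < q\<close>]
  have "mean_osc_power q Q f \<le> ennreal ((JN_const CARD('n) q * B) powr q)"
    using l(1) by (simp add: l(2) mean_osc_power_box[OF l(1) f] divide_ennreal_le_iff)
  then show ?thesis
    using assms JN_const_nonneg[of q "CARD('n)"] by (intro ennreal_power_le) auto
qed

theorem corollary2p7:
  assumes "CARD('n::finite) \<ge> 2"
  shows "\<forall>q::real. 1 < q \<longrightarrow>
    (\<exists>N::real. 0 \<le> N \<and>
      (\<forall>V::(real^'n) set. domain V \<and> bounded V \<longrightarrow>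
        (\<forall>\<phi>\<in>BMO V.
          bmo_seminorm V \<phi>
            \<le> (SUP Q\<in>cubes_in V. ennreal_power (mean_osc_power q Q \<phi>) (1 / q)) \<and>
          (SUP Q\<in>cubes_in V. ennreal_power (mean_osc_power q Q \<phi>) (1 / q))
            \<le> ennreal N * bmo_seminorm V \<phi>)))"
proof (intro allI impI exI conjI ballI)
  fix q :: real assume "1 < q"
  let ?N = "JN_const CARD('n) q"
  show N: "0 \<le> ?N"
    using \<open>1 < q\<close> by (intro JN_const_nonneg) auto
  fix V :: "(real^'n) set" and \<phi>
  assume "\<phi> \<in> BMO V"
  then have L1: "\<phi> \<in> L1_loc V" and fin: "bmo_seminorm V \<phi> < \<infinity>"
    by (auto simp: BMO_def)
  show "bmo_seminorm V \<phi> \<le> (SUP Q\<in>cubes_in V. ennreal_power (mean_osc_power q Q \<phi>) (1 / q))"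
    unfolding bmo_seminorm_def
    by (rule SUP_mono) (use mean_osc_le_ennreal_power[OF L1 _ \<open>1 < q\<close>] in blast)
  obtain b where b: "0 \<le> b" "bmo_seminorm V \<phi> = ennreal b"
    using fin by (cases "bmo_seminorm V \<phi>") auto
  show "(SUP Q\<in>cubes_in V. ennreal_power (mean_osc_power q Q \<phi>) (1 / q)) \<le> ennreal ?N * bmo_seminorm V \<phi>"
  proof (rule SUP_least, rule ennreal_le_epsilon)
    fix Q and e :: real
    assume Q: "Q \<in> cubes_in V" and "0 < e"
    \<comment> \<open>The seminorm \<open>b\<close> may be 0, but the exponential rate needs a
      positive bound. The slack contributes at most \<open>e\<close> after multiplication by
      \<open>?N\<close>, and the added 1 keeps the denominator positive.\<close>
    let ?B = "b + e / (?N + 1)"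
    have "0 < ?B"
      using b N \<open>0 < e\<close> by (intro add_nonneg_pos divide_pos_pos) auto
    moreover have "b \<le> ?B"
      using N \<open>0 < e\<close> by simp
    ultimately have "ennreal_power (mean_osc_power q Q \<phi>) (1 / q) \<le> ennreal (?N * ?B)"
      using L1 Q \<open>1 < q\<close> b by (intro ennreal_power_mean_osc_power_le) (auto intro: ennreal_leI)
    also have "?N * ?B \<le> ?N * b + e"
    proof -
      have "?N * e \<le> e * (?N + 1)"
        using N \<open>0 < e\<close> by (simp add: algebra_simps)
      then show ?thesis
        using N by (simp add: distrib_left pos_divide_le_eq)
    qed
    then have "ennreal (?N * ?B) \<le> ennreal (?N * b + e)"
      by (rule ennreal_leI)
    also have "\<dots> = ennreal ?N * bmo_seminorm V \<phi> + ennreal e"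
      using N b \<open>0 < e\<close> by (simp add: ennreal_mult)
    finally show "ennreal_power (mean_osc_power q Q \<phi>) (1 / q) \<le> ennreal ?N * bmo_seminorm V \<phi> + ennreal e" .
  qed
qed

end
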